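(* Let $n\geq 3$ be a natural number and let $G:=Q_n$ be the (generalized) quaternion group of order $2^n$. Then $$\Delta(G)=\begin{cases} 2 & \text{if } n=3,\\ 3 & \text{if } n\geq 4.\end{cases}$$
   Context: For $n\ge 3$, $Q_n:=\langle a,b\mid a^{2^{n-1}}=1,\ b^2=a^{2^{n-2}},\ a^b=a^{-1}\rangle$, where $a^b=b^{-1}ab$; this is the (generalized) quaternion group of order $2^n$. A subset $S$ of a group $G$ normally generates $G$ if $G$ is the normal closure of $S$ in $G$ (the smallest normal subgroup of $G$ containing $S$). Put $\mathrm{Conj}_G(S^{\pm1})=\{h^{-1}sh\mid h\in G,\ s\in S\text{ or }s^{-1}\in S\}$. If $S$ normally generates $G$, then for $g\in G$ let $\|g\|_S$ be the least $k\in\{0,1,2,\dots\}$ such that $g$ is a product of $k$ elements of $\mathrm{Conj}_G(S^{\pm1})$ (so $\|1\|_S=0$), and let $\|G\|_S=\sup\{\|g\|_S\mid g\in G\}$. The conjugacy diameter of $G$ is $\Delta(G)=\sup\{\|G\|_S\mid S\subseteq G\text{ finite and } S \text{ normally generates } G\}$. *)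

theory Defs
  imports "HOL-Algebra.Coset" "HOL-Library.Extended_Nat"
begin

section \<open>Group presentations\<close>

text \<open>
  A group word over the generators \<^typ>\<open>'x\<close>: the letter \<open>(x, True)\<close> stands for \<open>x\<close> and
  \<open>(x, False)\<close> for its formal inverse.
\<close>

type_synonym 'x word = "('x \<times> bool) list"

definition word_inv :: "'x word \<Rightarrow> 'x word" where
  "word_inv w = rev (map (\<lambda>(x, e). (x, \<not> e)) w)"

text \<open>
  The least congruence on words that cancels inverse letters and identifies the two sides of each
  relation \<open>u = v\<close>, given as a pair \<open>(u, v) \<in> R\<close>.
\<close>

inductive word_eq :: "('x word \<times> 'x word) set \<Rightarrow> 'x word \<Rightarrow> 'x word \<Rightarrow> bool"
  for R :: "('x word \<times> 'x word) set" where
  refl: "word_eq R w w"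
| sym: "word_eq R v w \<Longrightarrow> word_eq R w v"
| trans: "word_eq R u v \<Longrightarrow> word_eq R v w \<Longrightarrow> word_eq R u w"
| append: "word_eq R u u' \<Longrightarrow> word_eq R v v' \<Longrightarrow> word_eq R (u @ v) (u' @ v')"
| cancel: "word_eq R [(x, e), (x, \<not> e)] []"
| rel: "(u, v) \<in> R \<Longrightarrow> word_eq R u v"

definition word_class :: "('x word \<times> 'x word) set \<Rightarrow> 'x word \<Rightarrow> 'x word set" where
  "word_class R w = {w'. word_eq R w w'}"

text \<open>The group \<open>\<langle>X | R\<rangle>\<close>, where \<open>X\<close> consists of all elements of the type \<^typ>\<open>'x\<close>.\<close>

definition presented_group :: "('x word \<times> 'x word) set \<Rightarrow> 'x word set monoid" where
  "presented_group R =
     \<lparr>carrier = range (word_class R),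
      mult = (\<lambda>A B. \<Union>u\<in>A. \<Union>v\<in>B. word_class R (u @ v)),
      one = word_class R []\<rparr>"

lemma word_class_eq_iff: "word_class R u = word_class R v \<longleftrightarrow> word_eq R u v"
  unfolding word_class_def set_eq_iff mem_Collect_eq
  by (meson word_eq.refl word_eq.sym word_eq.trans)

lemma presented_group_mult:
  "word_class R u \<otimes>\<^bsub>presented_group R\<^esub> word_class R v = word_class R (u @ v)"
proof -
  have "word_class R (u' @ v') = word_class R (u @ v)"
    if "u' \<in> word_class R u" "v' \<in> word_class R v" for u' v'
    using that unfolding word_class_eq_iff
    by (simp add: word_class_def word_eq.append word_eq.sym)
  moreover have "u \<in> word_class R u" "v \<in> word_class R v"
    by (simp_all add: word_class_def word_eq.refl)
  ultimately have "(\<Union>u'\<in>word_class R u. \<Union>v'\<in>word_class R v. word_class R (u' @ v')) =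
      word_class R (u @ v)"
    by blast
  then show ?thesis
    by (simp add: presented_group_def)
qed

lemma word_inv_cancel: "word_eq R (word_inv w @ w) []"
proof (induction w)
  case Nil
  then show ?case by (simp add: word_inv_def word_eq.refl)
next
  case (Cons l w)
  obtain x e where l: "l = (x, e)" by force
  have "word_eq R [(x, \<not> e), (x, e)] []"
    using word_eq.cancel[of R x "\<not> e"] by simp
  then have "word_eq R (word_inv w @ [(x, \<not> e), (x, e)] @ w) (word_inv w @ [] @ w)"
    by (intro word_eq.append word_eq.refl)
  then show ?case
    using word_eq.trans[OF _ Cons.IH] by (simp add: l word_inv_def)
qed

lemma group_presented_group: "group (presented_group R)"
proof (rule groupI)
  fix A assume "A \<in> carrier (presented_group R)"
  then obtain w where w: "A = word_class R w" by (auto simp: presented_group_def)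
  have "word_class R (word_inv w) \<otimes>\<^bsub>presented_group R\<^esub> A = \<one>\<^bsub>presented_group R\<^esub>"
    unfolding w presented_group_mult
    by (simp add: presented_group_def word_class_eq_iff word_inv_cancel)
  then show "\<exists>B\<in>carrier (presented_group R). B \<otimes>\<^bsub>presented_group R\<^esub> A = \<one>\<^bsub>presented_group R\<^esub>"
    by (auto simp: presented_group_def)
next
  fix A assume "A \<in> carrier (presented_group R)"
  then obtain w where w: "A = word_class R w" by (auto simp: presented_group_def)
  have "\<one>\<^bsub>presented_group R\<^esub> = word_class R []" by (simp add: presented_group_def)
  then show "\<one>\<^bsub>presented_group R\<^esub> \<otimes>\<^bsub>presented_group R\<^esub> A = A"
    by (simp add: w presented_group_mult)
next
  fix A B C
  assume "A \<in> carrier (presented_group R)" "B \<in> carrier (presented_group R)"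
    "C \<in> carrier (presented_group R)"
  then obtain u v w where "A = word_class R u" "B = word_class R v" "C = word_class R w"
    by (auto simp: presented_group_def)
  then show "A \<otimes>\<^bsub>presented_group R\<^esub> B \<otimes>\<^bsub>presented_group R\<^esub> C =
      A \<otimes>\<^bsub>presented_group R\<^esub> (B \<otimes>\<^bsub>presented_group R\<^esub> C)"
    by (simp add: presented_group_mult)
next
  fix A B
  assume "A \<in> carrier (presented_group R)" "B \<in> carrier (presented_group R)"
  then obtain u v where "A = word_class R u" "B = word_class R v"
    by (auto simp: presented_group_def)
  then show "A \<otimes>\<^bsub>presented_group R\<^esub> B \<in> carrier (presented_group R)"
    by (simp add: presented_group_mult) (simp add: presented_group_def)
qed (simp add: presented_group_def)


section \<open>Generalized quaternion groups\<close>

datatype quaternion_gen = gen_a | gen_b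

definition quaternion_rels :: "nat \<Rightarrow> (quaternion_gen word \<times> quaternion_gen word) set" where
  "quaternion_rels n =
     (let a = (gen_a, True); b = (gen_b, True); a' = (gen_a, False); b' = (gen_b, False)
      in {(replicate (2 ^ (n - 1)) a, []),
          ([b, b], replicate (2 ^ (n - 2)) a),
          ([b', a, b], [a'])})"

definition quaternion_group :: "nat \<Rightarrow> quaternion_gen word set monoid" where
  "quaternion_group n = presented_group (quaternion_rels n)"


section \<open>Conjugacy diameter\<close>

definition normal_closure :: "('a, 'm) monoid_scheme \<Rightarrow> 'a set \<Rightarrow> 'a set" where
  "normal_closure G S = \<Inter>{N. N \<lhd> G \<and> S \<subseteq> N}"

definition normally_generates :: "('a, 'm) monoid_scheme \<Rightarrow> 'a set \<Rightarrow> bool" where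
  "normally_generates G S \<longleftrightarrow> S \<subseteq> carrier G \<and> normal_closure G S = carrier G"

definition conj_set :: "('a, 'm) monoid_scheme \<Rightarrow> 'a set \<Rightarrow> 'a set" where
  "conj_set G S =
     {inv\<^bsub>G\<^esub> h \<otimes>\<^bsub>G\<^esub> s \<otimes>\<^bsub>G\<^esub> h | h s.
        h \<in> carrier G \<and> s \<in> carrier G \<and> (s \<in> S \<or> inv\<^bsub>G\<^esub> s \<in> S)}"

definition list_prod :: "('a, 'm) monoid_scheme \<Rightarrow> 'a list \<Rightarrow> 'a" where
  "list_prod G xs = foldr (\<lambda>x y. x \<otimes>\<^bsub>G\<^esub> y) xs \<one>\<^bsub>G\<^esub>"

text \<open>
  \<open>conj_norm G S g\<close> is meaningful only if \<open>S\<close> normally generates \<open>G\<close> and \<open>g\<close> lies in \<open>G\<close>, in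
  which case a suitable \<open>k\<close> exists.
\<close>

definition conj_norm :: "('a, 'm) monoid_scheme \<Rightarrow> 'a set \<Rightarrow> 'a \<Rightarrow> nat" where
  "conj_norm G S g =
     (LEAST k. \<exists>xs. length xs = k \<and> set xs \<subseteq> conj_set G S \<and> g = list_prod G xs)"

definition conj_norm_sup :: "('a, 'm) monoid_scheme \<Rightarrow> 'a set \<Rightarrow> enat" where
  "conj_norm_sup G S = (SUP g\<in>carrier G. enat (conj_norm G S g))"

definition conj_diameter :: "('a, 'm) monoid_scheme \<Rightarrow> enat" where
  "conj_diameter G =
     (SUP S\<in>{S. S \<subseteq> carrier G \<and> finite S \<and> normally_generates G S}. conj_norm_sup G S)"

end

theory Submission
  imports Defs
begin

text \<open>
  Every element of \<open>Q\<^sub>n\<close> has the form \<open>a\<^sup>i b\<^sup>s\<close> with \<open>s\<close> in \<open>{0, 1}\<close> and \<open>i\<close> unique modulo \<open>2 m\<close>,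
  where \<open>m = 2\<^sup>n\<^sup>-\<^sup>2\<close>. The conjugacy classes outside \<open>\<langle>a\<rangle>\<close> are the sets of all \<open>a\<^sup>i b\<close> with
  \<open>i\<close> of fixed parity; inside \<open>\<langle>a\<rangle>\<close> they are the sets \<open>{a\<^sup>i, a\<^sup>-\<^sup>i}\<close>.

  A normally generating set is not contained in any of the three maximal subgroups. Hence its
  conjugates contain all \<open>a\<^sup>i b\<close>, and two factors suffice, or they contain some \<open>a\<^sup>r\<close> with \<open>r\<close> odd
  and all \<open>a\<^sup>i b\<close> with \<open>i\<close> of one parity. Then two factors reach everything except odd powers of \<open>a\<close>,
  which take at most three; for \<open>n = 3\<close> every odd power of \<open>a\<close> is conjugate to \<open>a\<^sup>r\<close>.
  For \<open>{a, b}\<close> the bounds are attained at \<open>a\<^sup>2\<close> if \<open>n = 3\<close>, and at \<open>a\<^sup>3\<close> if \<open>n > 3\<close>: parity in the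
  abelianization excludes two factors.
\<close>

section \<open>Multiplication and conjugation of normal forms\<close>

text \<open>\<open>E i s\<close> plays the role of \<open>a\<^sup>i b\<^sup>s\<close>.\<close>

locale quaternion_normal_form = group G for G (structure) +
  fixes m :: int and E :: "int \<Rightarrow> bool \<Rightarrow> 'a"
  assumes even_m: "even m" and m_ge: "m \<ge> 2"
    and carrier_eq: "carrier G = {E i s | i s. True}"
    and E_mult: "E i s \<otimes> E k t =
      E (i + (if s then - k else k) + (if s \<and> t then m else 0)) (s \<noteq> t)"
    and E_eq_iff: "E i s = E k t \<longleftrightarrow> s = t \<and> 2 * m dvd i - k"
begin

lemma E_closed [simp]: "E i s \<in> carrier G"
  by (auto simp: carrier_eq)

lemma one_eq: "\<one> = E 0 False"
proof -
  have "E 0 False \<otimes> E 0 False = E 0 False" by (simp add: E_mult)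
  then show ?thesis by (metis E_closed l_cancel_one)
qed

lemma inv_E: "inv (E i s) = (if s then E (i + m) True else E (- i) False)"
  by (rule inv_equality) (auto simp: E_mult one_eq E_eq_iff)

text \<open>This describes the conjugacy classes: powers of \<open>a\<close> are at most inverted,
  and exponents of \<open>a^i b\<close> keep their parity.\<close>

lemma conj_E: "inv (E k t) \<otimes> E i s \<otimes> E k t =
    (if s then E (if t then 2 * k - i else i - 2 * k) True else E (if t then - i else i) False)"
  by (cases s; cases t) (simp_all add: inv_E E_mult E_eq_iff)

section \<open>Parity of exponents and maximal subgroups\<close>

lemma odd_cong_E: "E i s = E k t \<Longrightarrow> odd i = odd k"
  using dvd_mult_left[of 2 m "i - k"] by (auto simp: E_eq_iff)

text \<open>For \<open>(p, q) \<noteq> (False, False)\<close> these are the three maximal subgroups, the kernels of the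
  nontrivial homomorphisms onto a group of order two.\<close>

definition parity_kernel :: "bool \<Rightarrow> bool \<Rightarrow> 'a set" where
  "parity_kernel p q = {E i s | i s. (p \<and> odd i) = (q \<and> s)}"

lemma E_in_parity_kernel_iff: "E i s \<in> parity_kernel p q \<longleftrightarrow> (p \<and> odd i) = (q \<and> s)"
proof
  assume "E i s \<in> parity_kernel p q"
  then obtain k t where eq: "E i s = E k t" and kt: "(p \<and> odd k) = (q \<and> t)"
    unfolding parity_kernel_def by blast
  show "(p \<and> odd i) = (q \<and> s)"
    using kt odd_cong_E[OF eq] eq[unfolded E_eq_iff] by simp
next
  assume "(p \<and> odd i) = (q \<and> s)"
  then show "E i s \<in> parity_kernel p q"
    unfolding parity_kernel_def by blast
qed

text \<open>Multiplication adds exponents up to signs and the term \<open>m\<close>, which is even,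
  so parities add.\<close>

lemma parity_kernel_normal: "parity_kernel p q \<lhd> G"
proof (rule normal_invI)
  show "subgroup (parity_kernel p q) G"
  proof (rule subgroupI)
    show "parity_kernel p q \<noteq> {}"
      using E_in_parity_kernel_iff[of 0 False] by auto
  next
    show "parity_kernel p q \<subseteq> carrier G" by (auto simp: parity_kernel_def)
  next
    fix x assume "x \<in> parity_kernel p q"
    then obtain i s where "x = E i s" "(p \<and> odd i) = (q \<and> s)"
      unfolding parity_kernel_def by blast
    then show "inv x \<in> parity_kernel p q"
      using even_m by (auto simp: inv_E E_in_parity_kernel_iff)
  next
    fix x y assume "x \<in> parity_kernel p q" "y \<in> parity_kernel p q"
    then obtain i s k t where "x = E i s" "(p \<and> odd i) = (q \<and> s)"
      "y = E k t" "(p \<and> odd k) = (q \<and> t)"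
      unfolding parity_kernel_def by blast
    then show "x \<otimes> y \<in> parity_kernel p q"
      using even_m by (auto simp: E_mult E_in_parity_kernel_iff)
  qed
next
  fix x h assume x: "x \<in> carrier G" and "h \<in> parity_kernel p q"
  then obtain i s where h: "h = E i s" "(p \<and> odd i) = (q \<and> s)"
    unfolding parity_kernel_def by blast
  obtain k t where "inv x = E k t" using inv_closed[OF x] carrier_eq by auto
  moreover from this have "x = inv (E k t)" using x by (metis inv_inv)
  ultimately have "x \<otimes> h \<otimes> inv x = inv (E k t) \<otimes> E i s \<otimes> E k t" using h by simp
  then show "x \<otimes> h \<otimes> inv x \<in> parity_kernel p q"
    using h(2) by (auto simp: conj_E E_in_parity_kernel_iff)
qed

text \<open>Otherwise the normal closure of \<open>S\<close> lies in a proper normal subgroup: at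
  least one of \<open>E 1 False\<close> and \<open>E 0 True\<close> is outside the kernel.\<close>

lemma normally_generates_parity:
  assumes S: "normally_generates G S" and pq: "p \<or> q"
  obtains i s where "E i s \<in> S" "(p \<and> odd i) \<noteq> (q \<and> s)"
proof (rule ccontr)
  assume "\<not> thesis"
  moreover have "S \<subseteq> carrier G" using S by (simp add: normally_generates_def)
  ultimately have "S \<subseteq> parity_kernel p q"
    using that unfolding carrier_eq parity_kernel_def by blast
  then have "normal_closure G S \<subseteq> parity_kernel p q"
    unfolding normal_closure_def using parity_kernel_normal by blast
  then have "E i s \<in> parity_kernel p q" for i s
    using S E_closed unfolding normally_generates_def by blast
  from this[of 1 False] this[of 0 True] show False
    using pq by (simp add: E_in_parity_kernel_iff)
qed

section \<open>Conjugates of elements of \<open>S\<close>\<close>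

lemma conj_set_True:
  assumes "E i True \<in> S" "even (k - i)"
  shows "E k True \<in> conj_set G S"
proof -
  from assms(2) obtain j where "k - i = 2 * j" ..
  then have "E k True = inv (E (- j) False) \<otimes> E i True \<otimes> E (- j) False"
    by (simp add: conj_E algebra_simps)
  then show ?thesis using assms(1) E_closed unfolding conj_set_def by blast
qed

lemma conj_set_False:
  assumes "E i False \<in> S"
  shows "E i False \<in> conj_set G S" "E (- i) False \<in> conj_set G S"
proof -
  have "E i False = inv (E 0 False) \<otimes> E i False \<otimes> E 0 False"
    "E (- i) False = inv (E 0 True) \<otimes> E i False \<otimes> E 0 True"
    by (simp_all add: conj_E)
  then show "E i False \<in> conj_set G S" "E (- i) False \<in> conj_set G S"
    using assms E_closed unfolding conj_set_def by blast+
qed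

lemma conj_set_cong:
  assumes "E i s \<in> conj_set G S" "2 * m dvd k - i"
  shows "E k s \<in> conj_set G S"
  using assms E_eq_iff[of k s i s] by simp

section \<open>The upper bound\<close>

abbreviation word_norm_le :: "'a set \<Rightarrow> nat \<Rightarrow> 'a \<Rightarrow> bool" where
  "word_norm_le S l g \<equiv>
    \<exists>xs. length xs \<le> l \<and> set xs \<subseteq> conj_set G S \<and> g = list_prod G xs"

lemma word_norm_le_1: "E i s \<in> conj_set G S \<Longrightarrow> 1 \<le> l \<Longrightarrow> word_norm_le S l (E i s)"
  by (rule exI[of _ "[E i s]"]) (simp add: list_prod_def)

lemma word_norm_le_2:
  assumes "E i s \<in> conj_set G S" "E k t \<in> conj_set G S" "g = E i s \<otimes> E k t" "2 \<le> l"
  shows "word_norm_le S l g"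
  using assms by (intro exI[of _ "[E i s, E k t]"]) (simp add: list_prod_def)

lemma word_norm_le_3:
  assumes "E h r \<in> conj_set G S" "E i s \<in> conj_set G S" "E k t \<in> conj_set G S"
    "g = E h r \<otimes> (E i s \<otimes> E k t)" "3 \<le> l"
  shows "word_norm_le S l g"
  using assms by (intro exI[of _ "[E h r, E i s, E k t]"]) (simp add: list_prod_def)

definition bound :: nat where "bound = (if m = 2 then 2 else 3)"

lemma word_norm_le_bound:
  assumes S: "normally_generates G S" and g: "g \<in> carrier G"
  shows "word_norm_le S bound g"
proof -
  obtain j t where g_eq: "g = E j t" using g carrier_eq by auto
  have bound_ge: "2 \<le> bound" by (simp add: bound_def)
  \<comment> \<open>Take an element of \<open>S\<close> outside each of the three maximal subgroups;
    the parities of \<open>p\<close>, \<open>i\<close>, \<open>k\<close> then force one of the two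
    cases below.\<close>
  obtain p where p: "E p True \<in> S"
    using normally_generates_parity[OF S, of False True] by auto
  obtain i s where i: "E i s \<in> S" "odd i"
    using normally_generates_parity[OF S, of True False] by auto
  obtain k r where k: "E k r \<in> S" "odd k \<noteq> r"
    using normally_generates_parity[OF S, of True True] by auto
  consider (reflections) "\<And>h. E h True \<in> conj_set G S" | (rotation) h where "odd h" "E h False \<in> S"
  proof -
    \<comment> \<open>\<open>p\<close> covers one parity class outside the powers of
      \<open>a\<close>, and \<open>l\<close> the other.\<close>
    have "E h True \<in> conj_set G S" if "E l True \<in> S" "odd (l - p)" for l h
      using conj_set_True[OF p, of h] conj_set_True[OF that(1), of h] that(2) by fastforce
    then show thesis
      using that i k by (cases "odd p"; cases s; cases r) auto
  qed
  then show ?thesis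
  proof cases
    case reflections
    show ?thesis
    proof (cases t)
      case True
      then show ?thesis unfolding g_eq using reflections word_norm_le_1 bound_ge by simp
    next
      case False
      show ?thesis unfolding g_eq
        \<comment> \<open>The product is \<open>a^(j - m) b b = a^j\<close>, as
          \<open>b^2 = a^m\<close>.\<close>
        by (rule word_norm_le_2[OF reflections reflections, of _ "j - m" 0])
          (simp_all add: E_mult False bound_ge)
    qed
  next
    case (rotation h)
    note C = conj_set_True[OF p] and R = conj_set_False[OF rotation(2)]
    consider "t" "even (j - p)" | "t" "odd (j - p)" | "\<not> t" "even j" | "\<not> t" "odd j" by blast
    then show ?thesis
    proof cases
      case 1
      then show ?thesis unfolding g_eq using C word_norm_le_1 bound_ge by simp
    next
      case 2
      show ?thesis unfolding g_eq
        by (rule word_norm_le_2[OF R(1) C[of "j - h"]])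
          (use 2 rotation bound_ge in \<open>auto simp: E_mult\<close>)
    next
      case 3
      show ?thesis unfolding g_eq
        \<comment> \<open>Both exponents have the parity of \<open>p\<close>, since \<open>j\<close>
          and \<open>m\<close> are even.\<close>
        by (rule word_norm_le_2[OF C[of "j + p - m"] C[of p]])
          (use 3 even_m bound_ge in \<open>auto simp: E_mult\<close>)
    next
      case 4
      show ?thesis
      proof (cases "m = 2")
        case True
        \<comment> \<open>Exponents count modulo 4 here, so \<open>h\<close> and \<open>- h\<close>
          represent both odd classes.\<close>
        have "4 dvd j - h \<or> 4 dvd j - (- h)" using 4 rotation(1) by presburger
        then have "E j False \<in> conj_set G S"
          using conj_set_cong[OF R(1)] conj_set_cong[OF R(2)] True by auto
        then show ?thesis using 4 g_eq word_norm_le_1 bound_ge by simp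
      next
        case False
        show ?thesis unfolding g_eq
          \<comment> \<open>Splitting off \<open>a^h\<close> leaves the even exponent
            \<open>j - h\<close>, for which two factors suffice as before.\<close>
          by (rule word_norm_le_3[OF R(1) C[of "j - h + p - m"] C[of p]])
            (use 4 rotation False even_m in \<open>auto simp: E_mult bound_def\<close>)
      qed
    qed
  qed
qed

text \<open>The upper bound supplies some product of conjugates, so a least length exists.\<close>

lemma conj_norm_attained:
  assumes "normally_generates G S" "g \<in> carrier G"
  shows "\<exists>xs. length xs = conj_norm G S g \<and> set xs \<subseteq> conj_set G S \<and> g = list_prod G xs"
  unfolding conj_norm_def
  by (rule LeastI_ex) (use word_norm_le_bound[OF assms] in blast)

lemma conj_norm_le_bound:
  assumes "normally_generates G S" "g \<in> carrier G"
  shows "conj_norm G S g \<le> bound"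
proof -
  obtain xs where xs: "length xs \<le> bound" "set xs \<subseteq> conj_set G S" "g = list_prod G xs"
    using word_norm_le_bound[OF assms] by blast
  have "conj_norm G S g \<le> length xs"
    unfolding conj_norm_def by (rule Least_le) (use xs in blast)
  then show ?thesis using xs(1) by simp
qed

section \<open>The lower bound, for the generators \<open>a\<close> and \<open>b\<close>\<close>

definition standard_generators :: "'a set" where
  "standard_generators = {E 1 False, E 0 True}"

lemma standard_generators_generate: "normally_generates G standard_generators"
proof -
  have "E i s \<in> N" if N: "N \<lhd> G" and "standard_generators \<subseteq> N" for N i s
  proof -
    interpret N: subgroup N G using N by (rule normal_imp_subgroup)
    have a: "E 1 False \<in> N" and b: "E 0 True \<in> N"
      using that(2) by (auto simp: standard_generators_def)
    have a': "E (- 1) False \<in> N" using N.m_inv_closed[OF a] by (simp add: inv_E)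
    have F: "E i False \<in> N"
    proof (induction i rule: int_induct[where k = 0])
      case base
      then show ?case using N.one_closed one_eq by simp
    next
      case (step1 i)
      then show ?case using N.m_closed[OF step1(2) a] by (simp add: E_mult)
    next
      case (step2 i)
      then show ?case using N.m_closed[OF step2(2) a'] by (simp add: E_mult)
    qed
    then show ?thesis
      using N.m_closed[OF F b] by (cases s) (auto simp: E_mult)
  qed
  then have "carrier G \<subseteq> normal_closure G standard_generators"
    unfolding normal_closure_def carrier_eq by blast
  moreover have "carrier G \<lhd> G" by (rule normal_invI) (auto intro: subgroup_self)
  then have "normal_closure G standard_generators \<subseteq> carrier G"
    unfolding normal_closure_def standard_generators_def by (intro Inter_lower) simp
  ultimately show ?thesis
    unfolding normally_generates_def by (simp add: standard_generators_def)
qed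

text \<open>Conjugation at most inverts \<open>a\<close>; \<open>b\<close> and its inverse
  \<open>a^m b\<close> have even exponent, a property that conjugation preserves.\<close>

lemma conj_set_standard_generators:
  assumes "E i s \<in> conj_set G standard_generators"
  shows "if s then even i else 2 * m dvd i - 1 \<or> 2 * m dvd i + 1"
proof -
  obtain h x where h: "h \<in> carrier G" and x: "x \<in> carrier G"
    "x \<in> standard_generators \<or> inv x \<in> standard_generators"
    and eq: "E i s = inv h \<otimes> x \<otimes> h"
    using assms unfolding conj_set_def by auto
  obtain k t where kt: "h = E k t" using h carrier_eq by auto
  have "x = y \<or> x = inv y" if "x = y \<or> inv x = y" for y
    using that x(1) by auto
  then have "x \<in> {E 1 False, E (- 1) False, E 0 True, E m True}"
    using x(2) unfolding standard_generators_def by (fastforce simp: inv_E)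
  then obtain l u where lu: "x = E l u" "if u then even l else l = 1 \<or> l = -1"
    using even_m by fastforce
  have is_eq: "E i s =
      (if u then E (if t then 2 * k - l else l - 2 * k) True else E (if t then - l else l) False)"
    using eq unfolding kt lu(1) conj_E .
  show ?thesis
  proof (cases u)
    case True
    then have *: "E i s = E (if t then 2 * k - l else l - 2 * k) True" using is_eq by simp
    show ?thesis
      using odd_cong_E[OF *] *[unfolded E_eq_iff] lu(2) True by (auto split: if_splits)
  next
    case False
    then have *: "E i s = E (if t then - l else l) False" using is_eq by simp
    show ?thesis
      using *[unfolded E_eq_iff] lu(2) False by (auto split: if_splits)
  qed
qed

lemma bound_attained: "\<exists>g\<in>carrier G. bound \<le> conj_norm G standard_generators g"
proof (rule bexI)
  define g where "g = E (if m = 2 then 2 else 3) False"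
  obtain xs where xs: "length xs = conj_norm G standard_generators g"
    "set xs \<subseteq> conj_set G standard_generators" "g = list_prod G xs"
    using conj_norm_attained[OF standard_generators_generate E_closed] unfolding g_def by blast
  have "m = 2 \<or> m \<ge> 4" using even_m m_ge by presburger
  \<comment> \<open>The shifts \<open>0\<close>, \<open>1\<close>, \<open>-1\<close> exclude in turn
    that \<open>g\<close> is the identity, \<open>a^(-1)\<close> or \<open>a\<close>.\<close>
  then have ndvd: "\<not> 2 * m dvd (if m = 2 then 2 else 3) + d" if "d \<in> {-1, 0, 1}" for d
    using zdvd_imp_le[of "2 * m" "(if m = 2 then 2 else 3) + d"] that by auto
  have "bound \<le> length xs"
  proof (rule ccontr)
    assume "\<not> bound \<le> length xs"
    then have "xs = [] \<or> (\<exists>x. xs = [x]) \<or> (\<exists>x y. xs = [x, y] \<and> m \<noteq> 2)"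
      by (cases xs; cases "tl xs") (auto simp: bound_def not_le split: if_splits)
    then consider "xs = []" | x where "xs = [x]" | x y where "xs = [x, y]" "m \<noteq> 2"
      by blast
    then show False
    proof cases
      case 1
      then show False using xs(3) ndvd[of 0] by (simp add: g_def list_prod_def one_eq E_eq_iff)
    next
      case (2 x)
      then have x: "x \<in> conj_set G standard_generators" using xs(2) by simp
      then have "x \<in> carrier G" by (auto simp: conj_set_def)
      then have "g = x" using xs(3) 2 by (simp add: list_prod_def)
      then have "g \<in> conj_set G standard_generators" using x by simp
      from conj_set_standard_generators[OF this[unfolded g_def]] show False
        using ndvd[of 1] ndvd[of "-1"] by simp
    next
      case (3 x y)
      then have in_conj: "x \<in> conj_set G standard_generators"
        "y \<in> conj_set G standard_generators"
        using xs(2) by auto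
      then have "x \<in> carrier G" "y \<in> carrier G" by (auto simp: conj_set_def)
      then obtain i s k t where xy: "x = E i s" "y = E k t" using carrier_eq by auto
      \<comment> \<open>Both factors lie outside \<open>parity_kernel True True\<close>, of index
        two, so their product lies inside; \<open>a^3\<close> does not.\<close>
      have parity: "odd j \<noteq> r" if "E j r \<in> conj_set G standard_generators" for j r
        using conj_set_standard_generators[OF that] dvd_mult_left[of 2 m "j - 1"]
          dvd_mult_left[of 2 m "j + 1"] by (auto split: if_splits)
      have *: "E 3 False = E (i + (if s then - k else k) + (if s \<and> t then m else 0)) (s \<noteq> t)"
        using 3 xs(3) by (simp add: g_def list_prod_def xy E_mult)
      then have "s = t" by (simp add: E_eq_iff)
      then show False
        using odd_cong_E[OF *] parity[of i s] parity[of k t] in_conj[unfolded xy] even_m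
        by (auto split: if_splits)
    qed
  qed
  then show "bound \<le> conj_norm G standard_generators g" using xs(1) by simp
  show "g \<in> carrier G" by (simp add: g_def)
qed

theorem conj_diameter_eq: "conj_diameter G = (if m = 2 then 2 else 3)"
proof -
  have "conj_diameter G = enat bound"
  proof (rule antisym)
    show "conj_diameter G \<le> enat bound"
      unfolding conj_diameter_def conj_norm_sup_def
      by (intro SUP_least) (simp add: conj_norm_le_bound)
  next
    obtain g where g: "g \<in> carrier G" "bound \<le> conj_norm G standard_generators g"
      using bound_attained by blast
    have "enat bound \<le> conj_norm_sup G standard_generators"
      unfolding conj_norm_sup_def using g by (intro SUP_upper2) auto
    then show "enat bound \<le> conj_diameter G"
      unfolding conj_diameter_def using standard_generators_generate
      by (intro SUP_upper2) (auto simp: standard_generators_def)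
  qed
  then show ?thesis by (simp add: bound_def numeral_eq_enat)
qed

end

section \<open>Consequences of the defining relations\<close>

lemma (in group) int_pow_conj:
  assumes "x \<in> carrier G" "y \<in> carrier G"
  shows "inv y \<otimes> x [^] (i :: int) \<otimes> y = (inv y \<otimes> x \<otimes> y) [^] i"
proof -
  have "(\<lambda>x. inv y \<otimes> x \<otimes> y) \<in> hom G G"
    using assms by (auto simp: hom_def m_assoc) (simp flip: m_assoc)
  then interpret group_hom G G "\<lambda>x. inv y \<otimes> x \<otimes> y"
    by (simp add: group_hom_def group_hom_axioms_def is_group)
  show ?thesis using hom_int_pow[OF assms(1)] .
qed

text \<open>The relations give the multiplication rule but cannot separate normal forms: the trivial
  group satisfies them as well.\<close>

locale quaternion_relations = group G for G (structure) +
  fixes m :: nat and a b :: 'a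
  assumes a_closed [simp]: "a \<in> carrier G" and b_closed [simp]: "b \<in> carrier G"
    and a_pow: "a [^] (2 * m) = \<one>" and b_square: "b \<otimes> b = a [^] m"
    and a_conj_b: "inv b \<otimes> a \<otimes> b = inv a"
begin

definition E :: "int \<Rightarrow> bool \<Rightarrow> 'a" where
  "E i s = a [^] i \<otimes> (if s then b else \<one>)"

lemma E_closed: "E i s \<in> carrier G"
  by (simp add: E_def)

lemma a_pow_cong:
  assumes "2 * int m dvd i - k"
  shows "a [^] i = a [^] k"
proof -
  obtain l where "i = k + int (2 * m) * l"
    using assms by (metis diff_eq_eq add.commute dvdE int_ops(7) of_nat_numeral)
  moreover have "a [^] (int (2 * m) * l) = \<one>"
    by (metis a_closed a_pow int_pow_int int_pow_one int_pow_pow)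
  ultimately show ?thesis by (simp add: int_pow_mult)
qed

lemma b_pow: "b \<otimes> a [^] (i :: int) = a [^] (- i) \<otimes> b"
proof -
  have "inv b \<otimes> a [^] (- i) \<otimes> b = a [^] i"
    using int_pow_conj[of a b "- i"] by (simp add: a_conj_b int_pow_neg int_pow_inv)
  then show ?thesis
    by (metis a_closed b_closed int_pow_closed inv_closed inv_solve_left m_assoc m_closed)
qed

lemma E_mult: "E i s \<otimes> E k t =
    E (i + (if s then - k else k) + (if s \<and> t then int m else 0)) (s \<noteq> t)"
proof -
  have "b \<otimes> (a [^] k \<otimes> x) = a [^] (- k) \<otimes> (b \<otimes> x)" if "x \<in> carrier G" for x
    using that by (simp add: b_pow flip: m_assoc)
  moreover have "a [^] j \<otimes> (a [^] l \<otimes> x) = a [^] (j + l) \<otimes> x"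
    if "x \<in> carrier G" for j l :: int and x
    using that by (simp add: int_pow_mult m_assoc)
  ultimately show ?thesis
    by (cases s; cases t)
      (simp_all add: E_def m_assoc b_pow b_square algebra_simps flip: int_pow_mult int_pow_int)
qed

end

section \<open>An action of words that separates normal forms\<close>

text \<open>
  Left multiplication by a letter on the normal forms \<open>a\<^sup>i b\<^sup>s\<close>. Words act on pairs with unreduced
  exponents; the relations hold only up to \<open>nf_cong\<close>, that is, modulo \<open>2 * m\<close>. The invariance of
  this action shows that distinct normal forms are distinct in the presented group.
\<close>

fun letter_act :: "int \<Rightarrow> quaternion_gen \<times> bool \<Rightarrow> int \<times> bool \<Rightarrow> int \<times> bool" where
  "letter_act m (gen_a, e) (i, s) = (if e then i + 1 else i - 1, s)"
| "letter_act m (gen_b, e) (i, s) = (if e = s then m - i else - i, \<not> s)"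

definition word_act :: "int \<Rightarrow> quaternion_gen word \<Rightarrow> int \<times> bool \<Rightarrow> int \<times> bool" where
  "word_act m w = foldr (letter_act m) w"

definition nf_cong :: "int \<Rightarrow> int \<times> bool \<Rightarrow> int \<times> bool \<Rightarrow> bool" where
  "nf_cong m x y \<longleftrightarrow> snd x = snd y \<and> 2 * m dvd fst x - fst y"

lemma nf_cong_refl: "nf_cong m x x"
  by (simp add: nf_cong_def)

lemma nf_cong_sym: "nf_cong m x y \<Longrightarrow> nf_cong m y x"
  by (simp add: nf_cong_def dvd_diff_commute)

lemma nf_cong_trans: "nf_cong m x y \<Longrightarrow> nf_cong m y z \<Longrightarrow> nf_cong m x z"
  unfolding nf_cong_def using dvd_add[of "2 * m" "fst x - fst y" "fst y - fst z"] by simp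

lemma letter_act_cong: "nf_cong m x y \<Longrightarrow> nf_cong m (letter_act m l x) (letter_act m l y)"
  by (cases "(m, l, x)" rule: letter_act.cases; cases y)
    (auto simp: nf_cong_def dvd_diff_commute)

lemma word_act_Nil [simp]: "word_act m [] x = x"
  and word_act_Cons [simp]: "word_act m (l # w) x = letter_act m l (word_act m w x)"
  by (simp_all add: word_act_def)

lemma word_act_cong: "nf_cong m x y \<Longrightarrow> nf_cong m (word_act m w x) (word_act m w y)"
  by (induction w) (simp_all add: letter_act_cong)

lemma word_act_append: "word_act m (u @ v) x = word_act m u (word_act m v x)"
  by (simp add: word_act_def)

lemma word_act_replicate_a: "word_act m (replicate k (gen_a, True)) (i, s) = (i + int k, s)"
  by (induction k) simp_all

text \<open>Each rule generating the congruence on words, including the three relations, is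
  respected by the action up to \<open>nf_cong\<close>.\<close>

lemma word_eq_imp_act_cong:
  assumes "word_eq (quaternion_rels n) u v" "n \<ge> 3"
  shows "nf_cong (2 ^ (n - 2)) (word_act (2 ^ (n - 2)) u x) (word_act (2 ^ (n - 2)) v x)"
  using assms(1)
proof (induction arbitrary: x)
  case (append u u' v v')
  then show ?case
    unfolding word_act_append using nf_cong_trans word_act_cong by blast
next
  case (cancel g e)
  \<comment> \<open>For \<open>gen_b\<close>, the constant enters with both letters or with neither,
    and \<open>m - (m - i) = i\<close>.\<close>
  then show ?case
    by (cases g; cases x) (auto simp: nf_cong_def)
next
  case (rel u v)
  obtain i s where x: "x = (i, s)" by force
  have "(2 :: int) ^ (n - 1) = 2 * 2 ^ (n - 2)"
    using \<open>n \<ge> 3\<close> by (simp flip: power_Suc add: Suc_diff_Suc numeral_2_eq_2)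
  moreover from rel have "u = replicate (2 ^ (n - 1)) (gen_a, True) \<and> v = [] \<or>
    u = [(gen_b, True), (gen_b, True)] \<and> v = replicate (2 ^ (n - 2)) (gen_a, True) \<or>
    u = [(gen_b, False), (gen_a, True), (gen_b, True)] \<and> v = [(gen_a, False)]"
    by (simp add: quaternion_rels_def Let_def)
  ultimately show ?case
    by (elim disjE conjE; simp add: x word_act_replicate_a nf_cong_def)
qed (blast intro: nf_cong_refl nf_cong_sym nf_cong_trans)+

section \<open>Normal forms in the presented group\<close>

theorem theorem1p5:
  fixes n :: nat
  assumes "n \<ge> 3"
  shows "conj_diameter (quaternion_group n) = (if n = 3 then 2 else 3)"
proof -
  define R where "R = quaternion_rels n"
  define G where "G = presented_group R"
  define M where "M = (2 :: nat) ^ (n - 2)"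
  define a where "a = word_class R [(gen_a, True)]"
  define b where "b = word_class R [(gen_b, True)]"
  interpret group G unfolding G_def by (rule group_presented_group)
  have mult: "word_class R u \<otimes>\<^bsub>G\<^esub> word_class R v = word_class R (u @ v)" for u v
    unfolding G_def by (rule presented_group_mult)
  have one: "\<one>\<^bsub>G\<^esub> = word_class R []" and carr: "carrier G = range (word_class R)"
    by (simp_all add: G_def presented_group_def)
  have closed: "word_class R w \<in> carrier G" for w by (simp add: carr)
  have inverse: "inv\<^bsub>G\<^esub> word_class R [(g, True)] = word_class R [(g, False)]" for g
    by (rule inv_equality)
      (use word_eq.cancel[of R g False] in \<open>auto simp: mult one closed word_class_eq_iff\<close>)
  have a_power: "a [^]\<^bsub>G\<^esub> k = word_class R (replicate k (gen_a, True))" for k :: nat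
    by (induction k) (simp_all add: one a_def mult flip: replicate_append_same)
  have two_M: "2 * M = 2 ^ (n - 1)"
    using assms unfolding M_def by (simp flip: power_Suc add: Suc_diff_Suc numeral_2_eq_2)
  have rel: "word_class R u = word_class R v" if "(u, v) \<in> R" for u v
    using that by (simp add: word_class_eq_iff word_eq.rel)
  interpret quaternion_relations G M a b
  proof
    show "a [^]\<^bsub>G\<^esub> (2 * M) = \<one>\<^bsub>G\<^esub>"
      unfolding a_power one two_M by (rule rel) (simp add: R_def quaternion_rels_def Let_def)
    show "b \<otimes>\<^bsub>G\<^esub> b = a [^]\<^bsub>G\<^esub> M"
      unfolding a_power b_def mult M_def by (rule rel) (simp add: R_def quaternion_rels_def Let_def)
    show "inv\<^bsub>G\<^esub> b \<otimes>\<^bsub>G\<^esub> a \<otimes>\<^bsub>G\<^esub> b = inv\<^bsub>G\<^esub> a"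
      unfolding a_def b_def inverse mult by (rule rel) (simp add: R_def quaternion_rels_def Let_def)
  qed (simp_all add: a_def b_def closed)
  \<comment> \<open>Acting on \<open>(0, False)\<close>, the pair of the identity, reads off the
    normal form. Reducing \<open>i\<close> modulo \<open>2 * M\<close> makes it nonnegative, so no
    inverse letters are needed.\<close>
  have E_word: "\<exists>w. E i s = word_class R w \<and> nf_cong M (word_act M w (0, False)) (i, s)" for i s
  proof -
    define w where "w = replicate (nat (i mod (2 * M))) (gen_a, True) @
      (if s then [(gen_b, True)] else [])"
    have pos: "0 < 2 * int M" by (simp add: M_def)
    have "2 * int M dvd i - i mod (2 * M)" by (simp add: minus_mod_eq_mult_div)
    then have "a [^]\<^bsub>G\<^esub> i = a [^]\<^bsub>G\<^esub> (i mod (2 * M))" by (rule a_pow_cong)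
    also have "\<dots> = a [^]\<^bsub>G\<^esub> nat (i mod (2 * M))"
      using pos by (simp add: int_pow_def2)
    finally have "E i s = word_class R w"
      unfolding E_def w_def by (simp add: a_power b_def mult one)
    moreover have "word_act M w (0, False) = (i mod (2 * M), s)"
      using pos by (simp add: w_def word_act_append word_act_replicate_a)
    ultimately show ?thesis
      by (auto simp: nf_cong_def dvd_diff_commute minus_mod_eq_mult_div)
  qed
  have word_E: "\<exists>i s. word_class R w = E i s" for w
  proof (induction w)
    case Nil
    have "word_class R [] = E 0 False" by (simp add: E_def flip: one)
    then show ?case by blast
  next
    case (Cons l w)
    obtain g e where l: "l = (g, e)" by force
    \<comment> \<open>\<open>a^M b b = a^(2 M) = 1\<close>, so \<open>a^M b\<close> is the inverse
      of \<open>b\<close>.\<close>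
    have "E M True \<otimes>\<^bsub>G\<^esub> E 0 True = \<one>\<^bsub>G\<^esub>"
      by (simp add: E_mult) (simp add: E_def a_pow_cong[of _ 0])
    moreover have E_b: "E 0 True = b" by (simp add: E_def)
    ultimately have "inv\<^bsub>G\<^esub> b = E M True" by (intro inv_equality) (simp_all add: E_closed)
    moreover have "E 1 False = a" "E (- 1) False = inv\<^bsub>G\<^esub> a"
      by (simp_all add: E_def int_pow_neg)
    moreover have "word_class R [l] \<in> {a, inv\<^bsub>G\<^esub> a, b, inv\<^bsub>G\<^esub> b}"
      unfolding l a_def b_def inverse by (cases g; cases e) simp_all
    ultimately obtain k t where "word_class R [l] = E k t"
      using E_b by (metis empty_iff insert_iff)
    moreover obtain i s where "word_class R w = E i s" using Cons.IH by blast
    ultimately have "word_class R (l # w) =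
        E (k + (if t then - i else i) + (if t \<and> s then int M else 0)) (t \<noteq> s)"
      using mult[of "[l]" w] E_mult[of k t i s] by simp
    then show ?case by blast
  qed
  interpret quaternion_normal_form G "int M" E
  proof
    have "M = 2 * 2 ^ (n - 3)" using assms unfolding M_def by (simp flip: power_Suc add: Suc_diff_Suc)
    then show "even (int M)" "2 \<le> int M" by simp_all
    show "carrier G = {E i s | i s. True}"
    proof
      show "carrier G \<subseteq> {E i s | i s. True}" unfolding carr using word_E by auto
      show "{E i s | i s. True} \<subseteq> carrier G" using E_closed by auto
    qed
    show "E i s = E k t \<longleftrightarrow> s = t \<and> 2 * int M dvd i - k" for i s k t
    proof
      assume eq: "E i s = E k t"
      obtain u where u: "E i s = word_class R u" "nf_cong M (word_act M u (0, False)) (i, s)"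
        using E_word by blast
      obtain v where v: "E k t = word_class R v" "nf_cong M (word_act M v (0, False)) (k, t)"
        using E_word by blast
      \<comment> \<open>Equal classes act congruently on \<open>(0, False)\<close>, so the normal
        forms read off agree modulo \<open>2 * M\<close>.\<close>
      have "word_eq R u v" using eq unfolding u(1) v(1) word_class_eq_iff .
      then have "nf_cong M (word_act M u (0, False)) (word_act M v (0, False))"
        using word_eq_imp_act_cong[OF _ assms] by (simp add: R_def M_def)
      then have "nf_cong M (i, s) (k, t)"
        by (intro nf_cong_trans[OF nf_cong_sym[OF u(2)] nf_cong_trans[OF _ v(2)]])
      then show "s = t \<and> 2 * int M dvd i - k" by (simp add: nf_cong_def)
    qed (simp add: E_def a_pow_cong)
  qed (rule E_mult)
  have "M = 2 \<longleftrightarrow> n = 3"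
    using assms power_inject_exp[of "2 :: nat" "n - 2" 1] by (auto simp: M_def)
  then have "conj_diameter G = (if n = 3 then 2 else 3)"
    using conj_diameter_eq by simp
  then show ?thesis
    unfolding quaternion_group_def G_def R_def .
qed

end
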